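(* Let $q\ge 5$ be an even integer. For $n\ge 0$ let $s_n$ be the number of elements in row $n$ of the hyperbolic Pascal triangle linked to the mosaic $\{4,q\}$, let $a_{n,i}$ ($0\le i\le s_n-1$) be the $i$-th element of row $n$, and let $\widetilde{s}_n=\sum_{i=0}^{s_n-1}(-1)^i a_{n,i}$. Then $\widetilde{s}_0=1$, and $$ \widetilde{s}_n=\begin{cases} 0, & \text{if } n=2t+1,\ n\ge 1,\\ -2(5-q)^{t-1}+2, & \text{if } n=2t,\ n\ge 2, \end{cases} $$ where $t$ denotes an integer.
   Context: Fix an integer $q\ge5$. The hyperbolic Pascal triangle linked to the regular mosaic $\{4,q\}$ consists of rows $n=0,1,2,\dots$; row $n$ is a finite sequence of vertices listed from left to right and indexed $0,1,\dots,s_n-1$, where $s_n$ is the number of vertices in row $n$. Each vertex has a type (base vertex, winger, $A$ or $B$) and a positive integer value; the value of the $i$-th vertex of row $n$ (the "$i$-th element" of row $n$) is denoted $a_{n,i}$. The rows are built as follows. - Row $0$ consists only of the base vertex, of value $1$. Row $1$ consists of two wingers, each of value $1$. - For $n\ge1$, the first and last vertices of row $n$ are the wingers and all other vertices have type $A$ or $B$. Each winger has $2$ descendants in row $n+1$, each type $A$ vertex has $q-2$, and each type $B$ vertex has $q-1$. The descendants of a vertex are placed from left to right, in the order of the vertices of row $n$. For any two neighbouring vertices of row $n$, the rightmost descendant of the left one and the leftmost descendant of the right one coincide; this common vertex of row $n+1$ has type $A$, and its value is the sum of the values of its two ascendants. The leftmost descendant of the left winger and the rightmost descendant of the right winger are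 the wingers of row $n+1$, each of value $1$. All remaining vertices of row $n+1$ have a single ascendant, have type $B$, and have the same value as that ascendant. Equivalently, for $n\ge 1$, row $n+1$ is obtained from row $n$, read left to right, as follows: start with a winger $1$; between the contributions of each two neighbouring vertices with values $x,y$ put one type $A$ vertex of value $x+y$; each type $A$ vertex of value $x$ contributes $q-4$ consecutive type $B$ vertices of value $x$, each type $B$ vertex of value $x$ contributes $q-3$ consecutive type $B$ vertices of value $x$, and wingers contribute no type $B$ vertices; end with a winger $1$. For example, row $2$ is $1,2,1$ (the $2$ being of type $A$), and row $3$ is $1,3,2,\dots,2,3,1$ with $q-4$ copies of $2$ (the $3$'s of type $A$, the $2$'s of type $B$). The value of a vertex equals the number of shortest paths to it from the base vertex. *)

theory Defs
  imports Main
begin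

datatype vtype = Base | Winger | TypeA | TypeB

type_synonym vertex = "vtype \<times> nat"

(* The base vertex has two descendants, the wingers of row 1; row 1 is given
   explicitly below, so this value is not used there. *)
fun descendants :: "nat \<Rightarrow> vtype \<Rightarrow> nat" where
  "descendants q Base = 2"
| "descendants q Winger = 2"
| "descendants q TypeA = q - 2"
| "descendants q TypeB = q - 1"

(* The leftmost and the rightmost descendant of a vertex are never of type B: each is
   either shared with the neighbouring vertex (type A) or a winger of the next row.
   All other descendants have this vertex as their only ascendant. *)
definition own_descendants :: "nat \<Rightarrow> vertex \<Rightarrow> vertex list" where
  "own_descendants q v = replicate (descendants q (fst v) - 2) (TypeB, snd v)"

(* All descendants of a row, from left to right, except the two wingers at the ends. *)
fun inner_descendants :: "nat \<Rightarrow> vertex list \<Rightarrow> vertex list" where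
  "inner_descendants q [] = []"
| "inner_descendants q [v] = own_descendants q v"
| "inner_descendants q (v # w # vs) =
     own_descendants q v @ (TypeA, snd v + snd w) # inner_descendants q (w # vs)"

definition next_row :: "nat \<Rightarrow> vertex list \<Rightarrow> vertex list" where
  "next_row q vs = (Winger, 1) # inner_descendants q vs @ [(Winger, 1)]"

fun row :: "nat \<Rightarrow> nat \<Rightarrow> vertex list" where
  "row q 0 = [(Base, 1)]"
| "row q (Suc 0) = [(Winger, 1), (Winger, 1)]"
| "row q (Suc (Suc n)) = next_row q (row q (Suc n))"

definition row_size :: "nat \<Rightarrow> nat \<Rightarrow> nat" where
  "row_size q n = length (row q n)"

definition elem :: "nat \<Rightarrow> nat \<Rightarrow> nat \<Rightarrow> nat" where
  "elem q n i = snd (row q n ! i)"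

definition alt_sum :: "nat \<Rightarrow> nat \<Rightarrow> int" where
  "alt_sum q n = (\<Sum>i<row_size q n. (- 1) ^ i * int (elem q n i))"

lemma row_2: "row q 2 = [(Winger, 1), (TypeA, 2), (Winger, 1)]"
  by (simp add: numeral_2_eq_2 next_row_def own_descendants_def)

lemma row_3:
  "row q 3 = [(Winger, 1), (TypeA, 3)] @ replicate (q - 4) (TypeB, 2) @ [(TypeA, 3), (Winger, 1)]"
  by (simp add: numeral_3_eq_3 next_row_def own_descendants_def)

end

(* Let T be the alternating sum over the type B vertices of a row in which the sign of a vertex is
   determined by the number of vertices of type other than B on its left. As q is even, type A
   vertices and wingers have an even number of own descendants and type B vertices an odd number.
   Hence in the alternating sum of row n + 1 the contributions of the type A vertices of row n
   cancel and what remains is T of row n, while the type B part alone is - T of row n. On the other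
   hand T of row n + 2 is minus the alternating sum of row n + 1 in which each vertex is weighted
   by its number of own descendants (0, q - 4 or q - 3). Together this gives
   T_{n+2} = (5 - q) T_n + (q - 4) w, where w, the signed sum over the wingers of row n + 1, is
   2 or 0 according to the parity of the length of that row. *)
theory Submission
  imports Defs
begin

section \<open>Alternating sums by recursion on the list, so that they split along appends\<close>

fun asum :: "('a \<Rightarrow> int) \<Rightarrow> 'a list \<Rightarrow> int" where
  "asum f [] = 0"
| "asum f (x # xs) = f x - asum f xs"

lemma asum_append: "asum f (xs @ ys) = asum f xs + (- 1) ^ length xs * asum f ys"
  by (induction xs) auto

lemma asum_replicate: "asum f (replicate k x) = (if even k then 0 else f x)"
  by (induction k) auto

lemma asum_eq_0: "(\<And>x. x \<in> set xs \<Longrightarrow> f x = 0) \<Longrightarrow> asum f xs = 0"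
  by (induction xs) auto

lemma asum_cong: "(\<And>x. x \<in> set xs \<Longrightarrow> f x = g x) \<Longrightarrow> asum f xs = asum g xs"
  by (induction xs) auto

lemma asum_add: "asum (\<lambda>x. f x + g x) xs = asum f xs + asum g xs"
  by (induction xs) auto

lemma asum_mult: "asum (\<lambda>x. c * f x) xs = c * asum f xs"
  by (induction xs) (auto simp: algebra_simps)

lemma asum_conv_sum: "asum f xs = (\<Sum>i<length xs. (- 1) ^ i * f (xs ! i))"
proof (induction xs)
  case (Cons x xs)
  show ?case
    by (simp add: Cons.IH sum.lessThan_Suc_shift sum_negf del: sum.lessThan_Suc)
qed simp

section \<open>Weights of vertices and the signed sum over type B vertices\<close>

definition vertex_value :: "vertex \<Rightarrow> int" where
  "vertex_value v = int (snd v)"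

definition typed_value :: "vtype \<Rightarrow> vertex \<Rightarrow> int" where
  "typed_value \<tau> v = (if fst v = \<tau> then vertex_value v else 0)"

definition own_value :: "nat \<Rightarrow> vertex \<Rightarrow> int" where
  "own_value q v = int (descendants q (fst v) - 2) * vertex_value v"

text \<open>The sum T of the overview. A type B vertex leaves the sign alone, so a block of such
  vertices adds up instead of cancelling.\<close>

fun B_sum :: "vertex list \<Rightarrow> int" where
  "B_sum [] = 0"
| "B_sum (v # vs) = (if fst v = TypeB then vertex_value v + B_sum vs else - B_sum vs)"

definition non_B :: "vertex list \<Rightarrow> nat" where
  "non_B vs = length (filter (\<lambda>v. fst v \<noteq> TypeB) vs)"

lemma non_B_Nil [simp]: "non_B [] = 0"
  and non_B_Cons [simp]: "non_B (v # vs) = (if fst v = TypeB then non_B vs else Suc (non_B vs))"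
  and non_B_append [simp]: "non_B (vs @ ws) = non_B vs + non_B ws"
  by (simp_all add: non_B_def)

lemma non_B_own [simp]: "non_B (own_descendants q v) = 0"
  by (simp add: non_B_def own_descendants_def)

lemma B_sum_append: "B_sum (vs @ ws) = B_sum vs + (- 1) ^ non_B vs * B_sum ws"
  by (induction vs) auto

lemma B_sum_own [simp]: "B_sum (own_descendants q v) = own_value q v"
proof -
  have "B_sum (replicate k (TypeB, snd v)) = int k * vertex_value v" for k
    by (induction k) (auto simp: vertex_value_def algebra_simps)
  then show ?thesis
    by (simp add: own_descendants_def own_value_def)
qed

lemma alt_sum_eq_asum: "alt_sum q n = asum vertex_value (row q n)"
  by (simp add: alt_sum_def asum_conv_sum row_size_def elem_def vertex_value_def)

lemma non_B_inner_descendants: "non_B (inner_descendants q vs) = length vs - 1"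
  by (induction q vs rule: inner_descendants.induct) auto

text \<open>Exactly one type A vertex separates consecutive blocks of own descendants, so the signs
  of whole blocks alternate.\<close>

lemma B_sum_inner_descendants: "B_sum (inner_descendants q vs) = asum (own_value q) vs"
  by (induction q vs rule: inner_descendants.induct) (auto simp: B_sum_append)

lemma B_sum_next_row: "B_sum (next_row q vs) = - asum (own_value q) vs"
  by (simp add: next_row_def B_sum_append B_sum_inner_descendants)

lemma non_B_next_row: "vs \<noteq> [] \<Longrightarrow> non_B (next_row q vs) = Suc (length vs)"
  by (cases vs) (simp_all add: next_row_def non_B_inner_descendants)

lemma set_inner_descendants:
  "v \<in> set (inner_descendants q vs) \<Longrightarrow> fst v = TypeA \<or> fst v = TypeB"
  by (induction q vs rule: inner_descendants.induct) (auto simp: own_descendants_def)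

section \<open>Passing from one row to the next for even q\<close>

context
  fixes q :: nat
  assumes q: "q \<ge> 4" "even q"
begin

lemma even_length_own_iff: "even (length (own_descendants q v)) \<longleftrightarrow> fst v \<noteq> TypeB"
  using q by (cases "fst v") (auto simp: own_descendants_def)

lemma asum_own:
  "asum f (own_descendants q v) = (if fst v = TypeB then f v else 0)"
  using q by (cases v; cases "fst v") (auto simp: own_descendants_def asum_replicate)

lemma power_length_own:
  "(- 1 :: int) ^ length (own_descendants q v) = (if fst v = TypeB then - 1 else 1)"
  using even_length_own_iff[of v] by (auto simp: minus_one_power_iff)

text \<open>A type B vertex and the type A vertex after its block contribute an even number of
  vertices, any other vertex an odd number. The last vertex has no type A vertex after it, which
  shifts the parity by one.\<close>

lemma even_length_inner_descendants:
  "vs \<noteq> [] \<Longrightarrow> fst (last vs) \<noteq> TypeB \<Longrightarrow>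
    even (length (inner_descendants q vs)) \<longleftrightarrow> odd (non_B vs)"
  by (induction vs rule: induct_list012) (auto simp: even_length_own_iff)

text \<open>By the same count, passing a vertex of \<open>vs\<close> flips the sign exactly if it is
  not of type B, as in \<open>B_sum\<close>. An odd block of equal copies leaves one copy.\<close>

lemma asum_B_inner_descendants:
  "asum (typed_value TypeB) (inner_descendants q vs) = B_sum vs"
proof (induction vs rule: induct_list012)
  case (3 v w vs)
  then show ?case
    by (auto simp: asum_append asum_own power_length_own typed_value_def)
qed (auto simp: asum_own typed_value_def)

text \<open>A value enters the type A sums on both sides of its block. Around an even block these
  have opposite signs and cancel; around an odd block both oppose the one surviving copy, leaving
  minus that copy. The two end terms correct for the missing outer neighbours.\<close>

lemma asum_inner_descendants:
  "vs \<noteq> [] \<Longrightarrow> fst (last vs) \<noteq> TypeB \<Longrightarrow>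
    asum vertex_value (inner_descendants q vs) =
      vertex_value (hd vs) - B_sum vs + (- 1) ^ non_B vs * vertex_value (last vs)"
proof (induction vs rule: induct_list012)
  case (3 v w vs)
  have "vertex_value (TypeA, snd v + snd w) = vertex_value v + vertex_value w"
    by (simp add: vertex_value_def)
  with 3 show ?case
    by (auto simp: asum_append asum_own power_length_own)
qed (auto simp: asum_own)

lemma even_length_next_row:
  assumes "vs \<noteq> []" "fst (last vs) \<noteq> TypeB"
  shows "even (length (next_row q vs)) \<longleftrightarrow> odd (non_B vs)"
  using even_length_inner_descendants[OF assms] by (simp add: next_row_def)

lemma asum_B_next_row: "asum (typed_value TypeB) (next_row q vs) = - B_sum vs"
  by (simp add: next_row_def asum_append asum_B_inner_descendants typed_value_def)

text \<open>The new wingers cancel the end terms of \<open>asum_inner_descendants\<close>; the left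
  one also reverses the sign of \<open>B_sum\<close>.\<close>

lemma asum_next_row:
  assumes "vs \<noteq> []" "hd vs = (Winger, 1)" "last vs = (Winger, 1)"
  shows "asum vertex_value (next_row q vs) = B_sum vs"
  using asum_inner_descendants[of vs] even_length_inner_descendants[of vs] assms
  by (auto simp: next_row_def asum_append vertex_value_def minus_one_power_iff)

section \<open>Shape and parity of the rows\<close>

lemma row_Suc:
  obtains vs where "row q (Suc n) = (Winger, 1) # vs @ [(Winger, 1)]"
    "\<And>v. v \<in> set vs \<Longrightarrow> fst v = TypeA \<or> fst v = TypeB"
proof (cases n)
  case 0
  then show ?thesis using that[of "[]"] by simp
next
  case (Suc m)
  show ?thesis
    by (rule that[of "inner_descendants q (row q n)"])
      (use Suc in \<open>auto simp: next_row_def dest!: set_inner_descendants\<close>)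
qed

lemma row_Suc_ends:
  "row q (Suc n) \<noteq> [] \<and> hd (row q (Suc n)) = (Winger, 1) \<and> last (row q (Suc n)) = (Winger, 1)"
  by (rule row_Suc[of n]) simp

lemma alt_sum_Suc_Suc: "alt_sum q (Suc (Suc n)) = B_sum (row q (Suc n))"
  using row_Suc_ends[of n] by (simp add: alt_sum_eq_asum asum_next_row)

lemma asum_winger_row:
  "asum (typed_value Winger) (row q (Suc n)) = (if odd (length (row q (Suc n))) then 2 else 0)"
proof -
  obtain vs where vs: "row q (Suc n) = (Winger, 1) # vs @ [(Winger, 1)]"
    "\<And>v. v \<in> set vs \<Longrightarrow> fst v = TypeA \<or> fst v = TypeB"
    using row_Suc[of n] by blast
  have "asum (typed_value Winger) vs = 0"
    by (rule asum_eq_0) (use vs(2) in \<open>force simp: typed_value_def\<close>)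
  then show ?thesis
    unfolding vs(1) by (simp add: asum_append typed_value_def vertex_value_def)
qed

text \<open>The weights 0, q - 4, q - 3 of wingers, A and B are the constant q - 4, corrected on
  wingers and on type B.\<close>

lemma asum_own_value_row:
  "asum (own_value q) (row q (Suc n)) =
    (int q - 4) * asum vertex_value (row q (Suc n)) + asum (typed_value TypeB) (row q (Suc n))
      - (int q - 4) * asum (typed_value Winger) (row q (Suc n))"
proof -
  have "own_value q v = (int q - 4) * vertex_value v +
      (typed_value TypeB v + (4 - int q) * typed_value Winger v)"
    if "v \<in> set (row q (Suc n))" for v
  proof -
    obtain vs where vs: "row q (Suc n) = (Winger, 1) # vs @ [(Winger, 1)]"
      "\<And>v. v \<in> set vs \<Longrightarrow> fst v = TypeA \<or> fst v = TypeB"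
      using row_Suc[of n] by blast
    have "fst v = Winger \<or> v \<in> set vs"
      using that unfolding vs(1) by auto
    then have "fst v \<noteq> Base"
      using vs(2) by fastforce
    then show ?thesis
      using q by (cases "fst v") (auto simp: own_value_def typed_value_def of_nat_diff algebra_simps)
  qed
  then have "asum (own_value q) (row q (Suc n)) = asum (\<lambda>v. (int q - 4) * vertex_value v +
      (typed_value TypeB v + (4 - int q) * typed_value Winger v)) (row q (Suc n))"
    by (rule asum_cong)
  also have "\<dots> = (int q - 4) * asum vertex_value (row q (Suc n)) +
      (asum (typed_value TypeB) (row q (Suc n)) +
        (4 - int q) * asum (typed_value Winger) (row q (Suc n)))"
    by (simp only: asum_add asum_mult)
  finally show ?thesis
    by (simp add: algebra_simps)
qed

text \<open>Parity passes over two rows: \<open>non_B\<close> of the row between decides the parity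
  of the later length and exceeds the earlier length by one.\<close>

lemma even_length_row: "even (length (row q (Suc n))) \<longleftrightarrow> even n"
proof (induction n rule: less_induct)
  case (less n)
  consider "n = 0" | "n = 1" | m where "n = Suc (Suc m)"
    by (metis One_nat_def not0_implies_Suc)
  then show ?case
  proof cases
    case 3
    have "even (length (row q (Suc n))) \<longleftrightarrow> odd (non_B (row q (Suc (Suc m))))"
      using row_Suc_ends[of "Suc m"] even_length_next_row[of "row q (Suc (Suc m))"] 3 by simp
    also have "\<dots> \<longleftrightarrow> even (length (row q (Suc m)))"
      using row_Suc_ends[of m] by (simp add: non_B_next_row)
    also have "\<dots> \<longleftrightarrow> even m"
      using less.IH[of m] 3 by simp
    finally show ?thesis
      using 3 by simp
  qed (simp_all add: next_row_def own_descendants_def)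
qed

section \<open>Recurrence over two rows and its solution\<close>

lemma B_sum_row_rec:
  "B_sum (row q (Suc (Suc (Suc n)))) =
    (5 - int q) * B_sum (row q (Suc n)) + (if even n then 2 * (int q - 4) else 0)"
proof -
  let ?r = "row q (Suc (Suc n))"
  have val: "asum vertex_value ?r = B_sum (row q (Suc n))"
    using alt_sum_Suc_Suc[of n] by (simp only: alt_sum_eq_asum)
  have B: "asum (typed_value TypeB) ?r = - B_sum (row q (Suc n))"
    by (simp add: asum_B_next_row)
  have W: "asum (typed_value Winger) ?r = (if even n then 2 else 0)"
    using asum_winger_row[of "Suc n"] even_length_row[of "Suc n"] by simp
  have "B_sum (row q (Suc (Suc (Suc n)))) = - asum (own_value q) ?r"
    by (simp only: row.simps B_sum_next_row)
  also have "\<dots> = (5 - int q) * B_sum (row q (Suc n)) + (if even n then 2 * (int q - 4) else 0)"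
    unfolding asum_own_value_row[of "Suc n"] val B W by (simp add: algebra_simps)
  finally show ?thesis .
qed

lemma B_sum_row_odd: "B_sum (row q (Suc (2 * t))) = 2 - 2 * (5 - int q) ^ t"
proof (induction t)
  case (Suc t)
  have "B_sum (row q (Suc (2 * Suc t))) = (5 - int q) * B_sum (row q (Suc (2 * t))) + 2 * (int q - 4)"
    using B_sum_row_rec[of "2 * t"] by simp
  \<comment> \<open>2 is the fixed point of x -> (5 - q) x + 2 (q - 4), so the distance to 2 is
    multiplied by 5 - q.\<close>
  then show ?case
    unfolding Suc.IH by (simp add: algebra_simps)
qed simp

lemma B_sum_row_even: "B_sum (row q (Suc (Suc (2 * t)))) = 0"
proof (induction t)
  case 0
  show ?case
    by (simp add: next_row_def own_descendants_def)
next
  case (Suc t)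
  then show ?case
    using B_sum_row_rec[of "Suc (2 * t)"] by simp
qed

end

theorem theorem1:
  fixes q :: nat
  assumes "q \<ge> 5" and "even q"
  shows "alt_sum q 0 = 1 \<and>
    (\<forall>n t :: nat. n \<ge> 1 \<and> n = 2 * t + 1 \<longrightarrow> alt_sum q n = 0) \<and>
    (\<forall>n t :: nat. n \<ge> 2 \<and> n = 2 * t \<longrightarrow> alt_sum q n = - 2 * (5 - int q) ^ (t - 1) + 2)"
proof -
  have q: "q \<ge> 4" "even q"
    using assms by simp_all
  have "alt_sum q (2 * t + 1) = 0" for t
  proof (cases t)
    \<comment> \<open>\<open>alt_sum_Suc_Suc\<close> starts at row 2, so row 1 is computed
      directly.\<close>
    case 0
    then show ?thesis
      by (simp add: alt_sum_eq_asum vertex_value_def)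
  next
    case (Suc k)
    then show ?thesis
      using alt_sum_Suc_Suc[OF q, of "Suc (2 * k)"] B_sum_row_even[OF q, of k] by simp
  qed
  moreover have "alt_sum q (2 * t) = - 2 * (5 - int q) ^ (t - 1) + 2" if "2 * t \<ge> 2" for t
  proof -
    obtain k where "t = Suc k"
      using \<open>2 * t \<ge> 2\<close> by (cases t) auto
    \<comment> \<open>Row 2k + 2 takes its value from \<open>B_sum\<close> of row 2k + 1, hence the
      exponent k = t - 1.\<close>
    then show ?thesis
      using alt_sum_Suc_Suc[OF q, of "2 * k"] B_sum_row_odd[OF q, of k] by simp
  qed
  moreover have "alt_sum q 0 = 1"
    by (simp add: alt_sum_eq_asum vertex_value_def)
  ultimately show ?thesis
    by blast
qed

end
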